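(* Let $i<j<k$ be indices in $\{1,\dots,n\}$ and consider the following inequalities in $(x,Y)$: (T37) $(\ell_k - u_k)Y_{ij} - \ell_iY_{jk} + \ell_iu_kx_j +\ell_j(u_k - \ell_k)x_i + \ell_i\ell_jx_k - \ell_i\ell_ju_k \leq 0$; (T38) $(\ell_k -u_k) Y_{ij} - \ell_jY_{ik} +\ell_i(u_k - \ell_k) x_j + \ell_ju_kx_i + \ell_i\ell_jx_k - \ell_i\ell_ju_k \leq 0$; (T39) $- \ell_iY_{jk} + (u_j - \ell_j)Y_{ik} + \ell_iu_kx_j + u_k(\ell_j -u_j)x_i + \ell_i\ell_jx_k - \ell_i\ell_ju_k \leq 0$; (T40) $(u_i - \ell_i)Y_{jk} - \ell_jY_{ik} + u_k(\ell_i - u_i)x_j + \ell_ju_kx_i + \ell_i\ell_jx_k - \ell_i\ell_ju_k \leq 0$; (T41) $- u_kY_{ij} + \ell_iu_kx_j + \ell_ju_kx_i - \ell_i\ell_ju_k \leq 0$; (T42) $- u_kY_{ij} + (u_i - \ell_i)Y_{jk} + (u_j - \ell_j)Y_{ik} + \ell_iu_kx_j + \ell_ju_kx_i + (\ell_i\ell_j - u_iu_j)x_k - \ell_i\ell_ju_k \leq 0$. Then (T42) cuts feasible solutions of $(P_{S_0,\ldots,S_m})$ (that is, it is violated by some feasible solution of $(P_{S_0,\ldots,S_m})$), while (T37), (T38), (T39), (T40) and (T41) are redundant for $(P_{S_0,\ldots,S_m})$ (that is, they are satisfied by every feasible solution of it).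
   Context: Problem $(P)$ is: minimize $\langle Q_0,xx^T\rangle+c_0^Tx$ over $x\in\mathbb{R}^n$ subject to $\langle Q_r,xx^T\rangle+c_r^Tx\le b_r$ for $r=1,\dots,m$ and $\ell_p\le x_p\le u_p$ for $p=1,\dots,n$. Here $Q_0,\dots,Q_m$ are symmetric $n\times n$ real matrices, $c_0,\dots,c_m\in\mathbb{R}^n$, $b\in\mathbb{R}^m$, $u\in\mathbb{R}^n$, $\ell\in\mathbb{R}_+^n$, the feasible domain of $(P)$ is assumed non-empty, and $\langle A,B\rangle=\sum_{p,q}a_{pq}b_{pq}$. Let $S_0,\dots,S_m$ be any symmetric positive semidefinite $n\times n$ matrices. The convex relaxation $(P_{S_0,\ldots,S_m})$ of $(P)$ is the problem of minimizing $\langle S_0,xx^T\rangle+c_0^Tx+\langle Q_0-S_0,Y\rangle$ over $(x,Y)\in\mathbb{R}^n\times\mathbb{R}^{n\times n}$ subject to: - $\ell_p\le x_p\le u_p$ for all $p$; - $\langle S_r,xx^T\rangle+c_r^Tx+\langle Q_r-S_r,Y\rangle\le b_r$ for $r=1,\dots,m$; - $Y_{qp}=Y_{pq}$ for all $p<q$; - the McCormick inequalities, for all $1\le p\le q\le n$: $Y_{pq}-u_qx_p-\ell_px_q+u_q\ell_p\le 0$, $Y_{pq}-u_px_q-\ell_qx_p+u_p\ell_q\le 0$, $-Y_{pq}+u_qx_p+u_px_q-u_pu_q\le 0$, $-Y_{pq}+\ell_qx_p+\ell_px_q-\ell_p\ell_q\le 0$.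
   Formalization: That (T42) cuts a feasible solution fails for some instances (e.g. ℓ_i=u_i, or constraints forcing x=ℓ); it is stated for boxes with ℓ<u at i, j, k and, given all other data, for some right-hand side b with (P) feasible, rather than for every b. *)

theory Defs
  imports "HOL-Analysis.Analysis"
begin

(* The coordinates 1, ..., n are the elements of an arbitrary finite linearly ordered type 'n.
   Families such as Q :: nat => real^'n^'n carry the objective data at index 0 and the data of
   the quadratic constraints at the indices 1..m; the value b 0 is never used.
   The trace inner product <A,B> is the inner product of the Euclidean space real^'n^'n. *)

type_synonym 'n rvec = "(real, 'n) vec"
type_synonym 'n rmat = "((real, 'n) vec, 'n) vec"

record 'a min_problem =
  objective :: "'a \<Rightarrow> real"
  feasible :: "'a set"

definition self_outer :: "'n::finite rvec \<Rightarrow> 'n rmat" where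
  "self_outer x = (\<chi> p q. x $ p * x $ q)"

definition pos_semidef :: "'n::finite rmat \<Rightarrow> bool" where
  "pos_semidef A \<longleftrightarrow> transpose A = A \<and> (\<forall>x. 0 \<le> x \<bullet> (A *v x))"

definition problem_P ::
  "nat \<Rightarrow> (nat \<Rightarrow> 'n::finite rmat) \<Rightarrow> (nat \<Rightarrow> 'n rvec) \<Rightarrow> (nat \<Rightarrow> real) \<Rightarrow> 'n rvec \<Rightarrow> 'n rvec
    \<Rightarrow> 'n rvec min_problem" where
  "problem_P m Q c b l u =
    \<lparr> objective = (\<lambda>x. Q 0 \<bullet> self_outer x + c 0 \<bullet> x),
      feasible = {x. (\<forall>r\<in>{1..m}. Q r \<bullet> self_outer x + c r \<bullet> x \<le> b r)
                   \<and> (\<forall>p. l $ p \<le> x $ p \<and> x $ p \<le> u $ p)} \<rparr>"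

definition valid_instance ::
  "nat \<Rightarrow> (nat \<Rightarrow> 'n::finite rmat) \<Rightarrow> (nat \<Rightarrow> 'n rvec) \<Rightarrow> (nat \<Rightarrow> real) \<Rightarrow> 'n rvec \<Rightarrow> 'n rvec \<Rightarrow> bool" where
  "valid_instance m Q c b l u \<longleftrightarrow>
    (\<forall>r\<in>{0..m}. transpose (Q r) = Q r) \<and> (\<forall>p. 0 \<le> l $ p) \<and> feasible (problem_P m Q c b l u) \<noteq> {}"

definition McCormick ::
  "'n::{finite,linorder} rvec \<Rightarrow> 'n rvec \<Rightarrow> 'n \<Rightarrow> 'n \<Rightarrow> 'n rvec \<Rightarrow> 'n rmat \<Rightarrow> bool" where
  "McCormick l u p q x Y \<longleftrightarrow>
      Y $ p $ q - u $ q * x $ p - l $ p * x $ q + u $ q * l $ p \<le> 0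
    \<and> Y $ p $ q - u $ p * x $ q - l $ q * x $ p + u $ p * l $ q \<le> 0
    \<and> - (Y $ p $ q) + u $ q * x $ p + u $ p * x $ q - u $ p * u $ q \<le> 0
    \<and> - (Y $ p $ q) + l $ q * x $ p + l $ p * x $ q - l $ p * l $ q \<le> 0"

definition relaxation ::
  "nat \<Rightarrow> (nat \<Rightarrow> 'n::{finite,linorder} rmat) \<Rightarrow> (nat \<Rightarrow> 'n rvec) \<Rightarrow> (nat \<Rightarrow> real)
    \<Rightarrow> 'n rvec \<Rightarrow> 'n rvec \<Rightarrow> (nat \<Rightarrow> 'n rmat) \<Rightarrow> ('n rvec \<times> 'n rmat) min_problem" where
  "relaxation m Q c b l u S =
    \<lparr> objective = (\<lambda>(x, Y). S 0 \<bullet> self_outer x + c 0 \<bullet> x + (Q 0 - S 0) \<bullet> Y),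
      feasible = {(x, Y).
          (\<forall>p. l $ p \<le> x $ p \<and> x $ p \<le> u $ p)
        \<and> (\<forall>r\<in>{1..m}. S r \<bullet> self_outer x + c r \<bullet> x + (Q r - S r) \<bullet> Y \<le> b r)
        \<and> (\<forall>p q. p < q \<longrightarrow> Y $ q $ p = Y $ p $ q)
        \<and> (\<forall>p q. p \<le> q \<longrightarrow> McCormick l u p q x Y)} \<rparr>"

definition redundant_for :: "('a \<Rightarrow> bool) \<Rightarrow> 'a min_problem \<Rightarrow> bool" where
  "redundant_for I P \<longleftrightarrow> (\<forall>z\<in>feasible P. I z)"

definition cuts_feasible_solution_of :: "('a \<Rightarrow> bool) \<Rightarrow> 'a min_problem \<Rightarrow> bool" where
  "cuts_feasible_solution_of I P \<longleftrightarrow> (\<exists>z\<in>feasible P. \<not> I z)"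

definition T37 :: "'n::finite rvec \<Rightarrow> 'n rvec \<Rightarrow> 'n \<Rightarrow> 'n \<Rightarrow> 'n \<Rightarrow> 'n rvec \<times> 'n rmat \<Rightarrow> bool" where
  "T37 l u i j k = (\<lambda>(x, Y).
     (l $ k - u $ k) * Y $ i $ j - l $ i * Y $ j $ k + l $ i * u $ k * x $ j
     + l $ j * (u $ k - l $ k) * x $ i + l $ i * l $ j * x $ k - l $ i * l $ j * u $ k \<le> 0)"

definition T38 :: "'n::finite rvec \<Rightarrow> 'n rvec \<Rightarrow> 'n \<Rightarrow> 'n \<Rightarrow> 'n \<Rightarrow> 'n rvec \<times> 'n rmat \<Rightarrow> bool" where
  "T38 l u i j k = (\<lambda>(x, Y).
     (l $ k - u $ k) * Y $ i $ j - l $ j * Y $ i $ k + l $ i * (u $ k - l $ k) * x $ j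
     + l $ j * u $ k * x $ i + l $ i * l $ j * x $ k - l $ i * l $ j * u $ k \<le> 0)"

definition T39 :: "'n::finite rvec \<Rightarrow> 'n rvec \<Rightarrow> 'n \<Rightarrow> 'n \<Rightarrow> 'n \<Rightarrow> 'n rvec \<times> 'n rmat \<Rightarrow> bool" where
  "T39 l u i j k = (\<lambda>(x, Y).
     - l $ i * Y $ j $ k + (u $ j - l $ j) * Y $ i $ k + l $ i * u $ k * x $ j
     + u $ k * (l $ j - u $ j) * x $ i + l $ i * l $ j * x $ k - l $ i * l $ j * u $ k \<le> 0)"

definition T40 :: "'n::finite rvec \<Rightarrow> 'n rvec \<Rightarrow> 'n \<Rightarrow> 'n \<Rightarrow> 'n \<Rightarrow> 'n rvec \<times> 'n rmat \<Rightarrow> bool" where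
  "T40 l u i j k = (\<lambda>(x, Y).
     (u $ i - l $ i) * Y $ j $ k - l $ j * Y $ i $ k + u $ k * (l $ i - u $ i) * x $ j
     + l $ j * u $ k * x $ i + l $ i * l $ j * x $ k - l $ i * l $ j * u $ k \<le> 0)"

definition T41 :: "'n::finite rvec \<Rightarrow> 'n rvec \<Rightarrow> 'n \<Rightarrow> 'n \<Rightarrow> 'n \<Rightarrow> 'n rvec \<times> 'n rmat \<Rightarrow> bool" where
  "T41 l u i j k = (\<lambda>(x, Y).
     - u $ k * Y $ i $ j + l $ i * u $ k * x $ j + l $ j * u $ k * x $ i
     - l $ i * l $ j * u $ k \<le> 0)"

definition T42 :: "'n::finite rvec \<Rightarrow> 'n rvec \<Rightarrow> 'n \<Rightarrow> 'n \<Rightarrow> 'n \<Rightarrow> 'n rvec \<times> 'n rmat \<Rightarrow> bool" where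
  "T42 l u i j k = (\<lambda>(x, Y).
     - u $ k * Y $ i $ j + (u $ i - l $ i) * Y $ j $ k + (u $ j - l $ j) * Y $ i $ k
     + l $ i * u $ k * x $ j + l $ j * u $ k * x $ i
     + (l $ i * l $ j - u $ i * u $ j) * x $ k - l $ i * l $ j * u $ k \<le> 0)"

end

theory Submission
  imports Defs
begin

text \<open>
  Write \<open>d\<^sub>p = u\<^sub>p - \<ell>\<^sub>p\<close>.  Each of (T37)--(T41) is a nonnegative combination of McCormick
  inequalities: (T41) is a multiple of one of them, and in the other four the McCormick
  inequalities of two of the pairs among \<open>i, j, k\<close>, weighted by \<open>d\<close> of one index and \<open>\<ell>\<close> of
  another, add up exactly to the claimed inequality.  The multipliers are nonnegative because
  \<open>\<ell> \<ge> 0\<close> and because a feasible point forces \<open>\<ell> \<le> u\<close>.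

  (T42) is different because it combines three pairs.  Put \<open>x\<^sub>p = \<ell>\<^sub>p + d\<^sub>p t\<^sub>p\<close> and
  \<open>Y\<^sub>p\<^sub>q = \<ell>\<^sub>p x\<^sub>q + \<ell>\<^sub>q x\<^sub>p - \<ell>\<^sub>p \<ell>\<^sub>q + d\<^sub>p d\<^sub>q y\<^sub>p\<^sub>q\<close>; where \<open>d\<^sub>p\<close> and
  \<open>d\<^sub>q\<close> are positive, the McCormick inequalities become
  \<open>max 0 (t\<^sub>p + t\<^sub>q - 1) \<le> y\<^sub>p\<^sub>q \<le> min t\<^sub>p t\<^sub>q\<close>, and the left-hand side of (T42) becomes
  \<open>d\<^sub>i d\<^sub>j (d\<^sub>k (y\<^sub>i\<^sub>k + y\<^sub>j\<^sub>k - t\<^sub>k) + \<ell>\<^sub>k (t\<^sub>i + t\<^sub>j - 1) - u\<^sub>k y\<^sub>i\<^sub>j)\<close>.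
  At the centre of the box, all \<open>t\<^sub>p = 1/2\<close>, McCormick leaves every \<open>y\<^sub>p\<^sub>q\<close> free in \<open>[0, 1/2]\<close>.
  The choice \<open>y\<^sub>i\<^sub>j = 0\<close> and \<open>y\<^sub>p\<^sub>q = 1/2\<close> elsewhere is the familiar violation of a triangle
  inequality (\<open>x\<^sub>i\<close> and \<open>x\<^sub>j\<close> both fully correlated with \<open>x\<^sub>k\<close>, yet anticorrelated with each
  other), and it gives the value \<open>d\<^sub>i d\<^sub>j d\<^sub>k / 2 > 0\<close>.  Right-hand sides \<open>b\<close> that are large enough
  keep the quadratic constraints from excluding this point.
\<close>

lemma valid_instance_bounds:
  assumes "valid_instance m Q c b l u"
  shows "0 \<le> l $ p" and "l $ p \<le> u $ p"
proof -
  from assms obtain x where "x \<in> feasible (problem_P m Q c b l u)"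
    unfolding valid_instance_def by blast
  then have "l $ p \<le> x $ p" and "x $ p \<le> u $ p"
    by (simp_all add: problem_P_def)
  then show "l $ p \<le> u $ p"
    by (rule order_trans)
  show "0 \<le> l $ p"
    using assms by (simp add: valid_instance_def)
qed

lemma relaxation_feasible_McCormick:
  assumes "(x, Y) \<in> feasible (relaxation m Q c b l u S)" and "p \<le> q"
  shows "McCormick l u p q x Y"
  using assms by (simp add: relaxation_def)

text \<open>
  Here and in the analogous proofs for (T38)--(T40), the two displayed products are the McCormick
  inequalities with their multipliers.  The multipliers are read off the coefficients of the
  entries of \<open>Y\<close>; the coefficients of \<open>x\<close> then determine which of the McCormick bounds to take.
\<close>

lemma McCormick_imp_T37:
  assumes "McCormick l u i j x Y" and "McCormick l u j k x Y"
    and "0 \<le> l $ i" and "l $ k \<le> u $ k"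
  shows "T37 l u i j k (x, Y)"
proof -
  have "(u $ k - l $ k) * (- (Y $ i $ j) + l $ j * x $ i + l $ i * x $ j - l $ i * l $ j) \<le> 0"
    using assms by (intro mult_nonneg_nonpos) (auto simp: McCormick_def)
  moreover have "l $ i * (- (Y $ j $ k) + l $ k * x $ j + l $ j * x $ k - l $ j * l $ k) \<le> 0"
    using assms by (intro mult_nonneg_nonpos) (auto simp: McCormick_def)
  ultimately show ?thesis
    unfolding T37_def by (simp add: algebra_simps)
qed

lemma McCormick_imp_T38:
  assumes "McCormick l u i j x Y" and "McCormick l u i k x Y"
    and "0 \<le> l $ j" and "l $ k \<le> u $ k"
  shows "T38 l u i j k (x, Y)"
proof -
  have "(u $ k - l $ k) * (- (Y $ i $ j) + l $ j * x $ i + l $ i * x $ j - l $ i * l $ j) \<le> 0"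
    using assms by (intro mult_nonneg_nonpos) (auto simp: McCormick_def)
  moreover have "l $ j * (- (Y $ i $ k) + l $ k * x $ i + l $ i * x $ k - l $ i * l $ k) \<le> 0"
    using assms by (intro mult_nonneg_nonpos) (auto simp: McCormick_def)
  ultimately show ?thesis
    unfolding T38_def by (simp add: algebra_simps)
qed

lemma McCormick_imp_T39:
  assumes "McCormick l u j k x Y" and "McCormick l u i k x Y"
    and "0 \<le> l $ i" and "l $ j \<le> u $ j"
  shows "T39 l u i j k (x, Y)"
proof -
  have "l $ i * (- (Y $ j $ k) + u $ k * x $ j + u $ j * x $ k - u $ j * u $ k) \<le> 0"
    using assms by (intro mult_nonneg_nonpos) (auto simp: McCormick_def)
  moreover have "(u $ j - l $ j) * (Y $ i $ k - u $ k * x $ i - l $ i * x $ k + u $ k * l $ i) \<le> 0"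
    using assms by (intro mult_nonneg_nonpos) (auto simp: McCormick_def)
  ultimately show ?thesis
    unfolding T39_def by (simp add: algebra_simps)
qed

lemma McCormick_imp_T40:
  assumes "McCormick l u j k x Y" and "McCormick l u i k x Y"
    and "0 \<le> l $ j" and "l $ i \<le> u $ i"
  shows "T40 l u i j k (x, Y)"
proof -
  have "(u $ i - l $ i) * (Y $ j $ k - u $ k * x $ j - l $ j * x $ k + u $ k * l $ j) \<le> 0"
    using assms by (intro mult_nonneg_nonpos) (auto simp: McCormick_def)
  moreover have "l $ j * (- (Y $ i $ k) + u $ k * x $ i + u $ i * x $ k - u $ i * u $ k) \<le> 0"
    using assms by (intro mult_nonneg_nonpos) (auto simp: McCormick_def)
  ultimately show ?thesis
    unfolding T40_def by (simp add: algebra_simps)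
qed

lemma McCormick_imp_T41:
  assumes "McCormick l u i j x Y" and "0 \<le> u $ k"
  shows "T41 l u i j k (x, Y)"
proof -
  have "u $ k * (- (Y $ i $ j) + l $ j * x $ i + l $ i * x $ j - l $ i * l $ j) \<le> 0"
    using assms by (intro mult_nonneg_nonpos) (auto simp: McCormick_def)
  then show ?thesis
    unfolding T41_def by (simp add: algebra_simps)
qed

definition box_centre :: "'n::finite rvec \<Rightarrow> 'n rvec \<Rightarrow> 'n rvec" where
  "box_centre l u = (\<chi> p. (l $ p + u $ p) / 2)"

text \<open>
  Over the box centre, the largest and the smallest value that the McCormick inequalities leave to
  an entry of \<open>Y\<close> are the averages of the products at the two ends of a diagonal of the rectangle
  \<open>[\<ell>\<^sub>p, u\<^sub>p] \<times> [\<ell>\<^sub>q, u\<^sub>q]\<close>: the increasing diagonal gives \<open>y\<^sub>p\<^sub>q = 1/2\<close> and the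
  decreasing one gives \<open>y\<^sub>p\<^sub>q = 0\<close>.
\<close>

definition frustrated_products :: "'n::finite rvec \<Rightarrow> 'n rvec \<Rightarrow> 'n \<Rightarrow> 'n \<Rightarrow> 'n rmat" where
  "frustrated_products l u i j =
    (\<chi> p q. if {p, q} = {i, j} then (l $ p * u $ q + u $ p * l $ q) / 2
            else (l $ p * l $ q + u $ p * u $ q) / 2)"

lemma frustrated_products_symmetric:
  "frustrated_products l u i j $ q $ p = frustrated_products l u i j $ p $ q"
  by (simp add: frustrated_products_def insert_commute mult.commute add.commute)

lemma McCormick_frustrated_products:
  assumes "l $ p \<le> u $ p" and "l $ q \<le> u $ q"
  shows "McCormick l u p q (box_centre l u) (frustrated_products l u i j)"
proof -
  \<comment> \<open>At either average two of the four inequalities are tight, and the other two have slack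
      \<open>d\<^sub>p d\<^sub>q / 2\<close>.\<close>
  have "0 \<le> (u $ p - l $ p) * (u $ q - l $ q)"
    using assms by simp
  then show ?thesis
    by (simp add: McCormick_def box_centre_def frustrated_products_def field_simps)
qed

lemma not_T42_frustrated_products:
  assumes "i \<noteq> k" and "j \<noteq> k"
    and "l $ i < u $ i" and "l $ j < u $ j" and "l $ k < u $ k"
  shows "\<not> T42 l u i j k (box_centre l u, frustrated_products l u i j)"
proof -
  have "{i, k} \<noteq> {i, j}" and "{j, k} \<noteq> {i, j}"
    using assms(1,2) by auto
  moreover have "0 < (u $ i - l $ i) * (u $ j - l $ j) * (u $ k - l $ k)"
    using assms by simp
  ultimately show ?thesis
    by (simp add: T42_def box_centre_def frustrated_products_def field_simps)
qed

text \<open>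
  The right-hand sides are the only obstruction to feasibility that McCormick does not control.
  Taking the larger of the values at \<open>x\<close> of the original constraint and at \<open>(x, Y)\<close> of the relaxed
  one keeps \<open>x\<close> feasible for the original problem and \<open>(x, Y)\<close> for the relaxation.
\<close>

lemma exists_valid_instance_feasible:
  assumes "\<forall>r\<in>{0..m}. transpose (Q r) = Q r" and "\<And>p. 0 \<le> l $ p"
    and "\<And>p. l $ p \<le> x $ p \<and> x $ p \<le> u $ p"
    and "\<And>p q. p < q \<Longrightarrow> Y $ q $ p = Y $ p $ q"
    and "\<And>p q. p \<le> q \<Longrightarrow> McCormick l u p q x Y"
  shows "\<exists>b. valid_instance m Q c b l u \<and> (x, Y) \<in> feasible (relaxation m Q c b l u S)"
proof -
  define b where "b r = max (Q r \<bullet> self_outer x + c r \<bullet> x)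
    (S r \<bullet> self_outer x + c r \<bullet> x + (Q r - S r) \<bullet> Y)" for r
  have "x \<in> feasible (problem_P m Q c b l u)"
    using assms(3) by (simp add: problem_P_def b_def)
  then have "valid_instance m Q c b l u"
    using assms(1,2) by (auto simp: valid_instance_def)
  moreover have "(x, Y) \<in> feasible (relaxation m Q c b l u S)"
    using assms(3-5) by (simp add: relaxation_def b_def)
  ultimately show ?thesis
    by blast
qed

theorem proposition7:
  fixes i j k :: "'n::{finite,linorder}"
  assumes "i < j" and "j < k"
  shows
    "(\<forall>(m::nat) (Q :: nat \<Rightarrow> 'n rmat) (c :: nat \<Rightarrow> 'n rvec) (l :: 'n rvec) (u :: 'n rvec)
        (S :: nat \<Rightarrow> 'n rmat).
        (\<forall>r\<in>{0..m}. transpose (Q r) = Q r) \<longrightarrow> (\<forall>r\<in>{0..m}. pos_semidef (S r)) \<longrightarrow>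
        (\<forall>p. 0 \<le> l $ p \<and> l $ p \<le> u $ p) \<longrightarrow> l $ i < u $ i \<longrightarrow> l $ j < u $ j \<longrightarrow> l $ k < u $ k \<longrightarrow>
        (\<exists>b. valid_instance m Q c b l u \<and>
             cuts_feasible_solution_of (T42 l u i j k) (relaxation m Q c b l u S)))
     \<and>
     (\<forall>(m::nat) (Q :: nat \<Rightarrow> 'n rmat) (c :: nat \<Rightarrow> 'n rvec) (b :: nat \<Rightarrow> real)
        (l :: 'n rvec) (u :: 'n rvec) (S :: nat \<Rightarrow> 'n rmat).
        valid_instance m Q c b l u \<longrightarrow> (\<forall>r\<in>{0..m}. pos_semidef (S r)) \<longrightarrow>
        redundant_for (T37 l u i j k) (relaxation m Q c b l u S) \<and>
        redundant_for (T38 l u i j k) (relaxation m Q c b l u S) \<and>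
        redundant_for (T39 l u i j k) (relaxation m Q c b l u S) \<and>
        redundant_for (T40 l u i j k) (relaxation m Q c b l u S) \<and>
        redundant_for (T41 l u i j k) (relaxation m Q c b l u S))"
proof (intro conjI allI impI)
  fix m :: nat and Q :: "nat \<Rightarrow> 'n rmat" and c :: "nat \<Rightarrow> 'n rvec" and l u :: "'n rvec"
    and S :: "nat \<Rightarrow> 'n rmat"
  assume sym: "\<forall>r\<in>{0..m}. transpose (Q r) = Q r"
    and bounds: "\<forall>p. 0 \<le> l $ p \<and> l $ p \<le> u $ p"
    and strict: "l $ i < u $ i" "l $ j < u $ j" "l $ k < u $ k"
  let ?x = "box_centre l u" and ?Y = "frustrated_products l u i j"
  have "l $ p \<le> ?x $ p \<and> ?x $ p \<le> u $ p" for p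
    using bounds[rule_format, of p] by (simp add: box_centre_def)
  then have "\<exists>b. valid_instance m Q c b l u \<and> (?x, ?Y) \<in> feasible (relaxation m Q c b l u S)"
    using bounds
    by (intro exists_valid_instance_feasible sym frustrated_products_symmetric
        McCormick_frustrated_products) auto
  moreover have "\<not> T42 l u i j k (?x, ?Y)"
    using not_T42_frustrated_products strict assms by (metis less_irrefl less_trans)
  ultimately show "\<exists>b. valid_instance m Q c b l u \<and>
      cuts_feasible_solution_of (T42 l u i j k) (relaxation m Q c b l u S)"
    unfolding cuts_feasible_solution_of_def by blast
next
  fix m :: nat and Q :: "nat \<Rightarrow> 'n rmat" and c :: "nat \<Rightarrow> 'n rvec" and b :: "nat \<Rightarrow> real"
    and l u :: "'n rvec" and S :: "nat \<Rightarrow> 'n rmat"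
  assume valid: "valid_instance m Q c b l u"
  let ?R = "relaxation m Q c b l u S"
  note bounds = valid_instance_bounds[OF valid]
  have "0 \<le> u $ k"
    using bounds by (rule order_trans)
  moreover have "i \<le> j" "j \<le> k" "i \<le> k"
    using assms by auto
  ultimately show "redundant_for (T37 l u i j k) ?R" "redundant_for (T38 l u i j k) ?R"
    "redundant_for (T39 l u i j k) ?R" "redundant_for (T40 l u i j k) ?R"
    "redundant_for (T41 l u i j k) ?R"
    unfolding redundant_for_def
    by (auto intro!: McCormick_imp_T37 McCormick_imp_T38 McCormick_imp_T39 McCormick_imp_T40
        McCormick_imp_T41 bounds elim!: relaxation_feasible_McCormick)
qed

end
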